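(* Let $X$ be a set, $G$ a group acting transitively on $X$, and let $G$ act on $\mathbb{C}^X$ by $\tau_g(f)(x)=f(g^{-1}x)$. Let $\mathcal{K}$ be a reproducing kernel Kreĭn space in $\mathbb{C}^X$, invariant with respect to $\tau$, with reproducing kernel function $K$. Let $\omega\in X$ and let $\varpi=\{g\in G: g\omega=\omega\}$ be its isotropy group, and $\mathcal{K}^{\varpi}=\{k\in\mathcal{K}:\tau_\varrho(k)=k\ \forall\varrho\in\varpi\}$. Then: 1. $K(gx,gy)=K(x,y)$ for all $g\in G$ and all $(x,y)\in X^2$; 2. if $\mathcal{K}\ne\{0\}$ then $\mathcal{K}^{\varpi}\neq\{0\}$; 3. if $\dim(\mathcal{K}^{\varpi})=1$ then the representation of $G$ on $\mathcal{K}$ is regularly irreducible.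
   Context: A Kreĭn space is a space $\mathcal{K}$ with a Hermitian sesquilinear form $[\cdot,\cdot]$ admitting a fundamental symmetry $J$ ($J^2=I$, $\langle x,y\rangle=[Jx,y]$ a Hilbert inner product); its topology is that of any such Hilbert norm. A reproducing kernel Kreĭn space in $\mathbb{C}^X$ is a Kreĭn space that is a linear subspace of $\mathbb{C}^X$ with continuous inclusion ($\mathbb{C}^X$ with pointwise convergence); its reproducing kernel function $K$ on $X^2$ is characterized by $K(x,\cdot)\in\mathcal{K}$ and $[K(x,\cdot),k]_{\mathcal{K}}=k(x)$ for all $x\in X$, $k\in\mathcal{K}$. $\mathcal{K}$ is invariant with respect to $\tau$ if, for every $g\in G$, $\tau_g(\mathcal{K})\subset\mathcal{K}$ and $\tau_g$ acts on $\mathcal{K}$ as a unitary operator for $[\cdot,\cdot]$. A subspace is regular if it is closed and a Kreĭn space for the restricted form; the representation is regularly irreducible if $\mathcal{K}$ has no invariant regular subspace other than $0$ and $\mathcal{K}$. *)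

theory Defs
  imports
    "HOL-Analysis.Analysis"
    "HOL-Library.Function_Algebras"
    "HOL-Algebra.Group_Action"
begin

(* All spaces below are linear subspaces V of an ambient complex vector space 'v; forms and
   operators are total functions of which only the values on V matter.  Sesquilinear forms
   are linear in the second argument and conjugate-linear in the first. *)

locale hermitian_space = vector_space smul
  for smul :: "complex \<Rightarrow> 'v::ab_group_add \<Rightarrow> 'v" +
  fixes V :: "'v set" and B :: "'v \<Rightarrow> 'v \<Rightarrow> complex"
  assumes subspace_V: "subspace V"
    and form_add_right: "\<lbrakk>x \<in> V; y \<in> V; z \<in> V\<rbrakk> \<Longrightarrow> B x (y + z) = B x y + B x z"
    and form_scale_right: "\<lbrakk>x \<in> V; y \<in> V\<rbrakk> \<Longrightarrow> B x (smul c y) = c * B x y"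
    and hermitian: "\<lbrakk>x \<in> V; y \<in> V\<rbrakk> \<Longrightarrow> B y x = cnj (B x y)"

(* Metric_space demands nonnegativity and symmetry of the distance on the whole type, hence
   the value 0 outside V. *)
definition form_dist ::
    "'v::ab_group_add set \<Rightarrow> ('v \<Rightarrow> 'v \<Rightarrow> complex) \<Rightarrow> 'v \<Rightarrow> 'v \<Rightarrow> real" where
  "form_dist V H x y = (if x \<in> V \<and> y \<in> V then sqrt (Re (H (x - y) (x - y))) else 0)"

locale hilbert_space_on = hermitian_space smul V H
  for smul :: "complex \<Rightarrow> 'v::ab_group_add \<Rightarrow> 'v" and V H +
  assumes positive: "\<lbrakk>x \<in> V; x \<noteq> 0\<rbrakk> \<Longrightarrow> 0 < Re (H x x)"
    and complete: "Metric_space.mcomplete V (form_dist V H)"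

definition linear_operator_on ::
    "(complex \<Rightarrow> 'v \<Rightarrow> 'v) \<Rightarrow> 'v set \<Rightarrow> ('v::ab_group_add \<Rightarrow> 'v) \<Rightarrow> bool" where
  "linear_operator_on smul V T \<longleftrightarrow> T ` V \<subseteq> V
     \<and> (\<forall>x\<in>V. \<forall>y\<in>V. T (x + y) = T x + T y)
     \<and> (\<forall>c. \<forall>x\<in>V. T (smul c x) = smul c (T x))"

definition fundamental_symmetry ::
    "(complex \<Rightarrow> 'v::ab_group_add \<Rightarrow> 'v) \<Rightarrow> 'v set \<Rightarrow> ('v \<Rightarrow> 'v \<Rightarrow> complex) \<Rightarrow> ('v \<Rightarrow> 'v) \<Rightarrow> bool" where
  "fundamental_symmetry smul V B J \<longleftrightarrow> linear_operator_on smul V J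
     \<and> (\<forall>x\<in>V. J (J x) = x)
     \<and> hilbert_space_on smul V (\<lambda>x y. B (J x) y)"

locale krein_space = hermitian_space smul V B
  for smul :: "complex \<Rightarrow> 'v::ab_group_add \<Rightarrow> 'v" and V B +
  assumes ex_fundamental_symmetry: "\<exists>J. fundamental_symmetry smul V B J"

(* The Hilbert norms of any two fundamental symmetries of a Krein space are equivalent,
   so the topology does not depend on the one chosen here. *)
definition krein_topology ::
    "(complex \<Rightarrow> 'v::ab_group_add \<Rightarrow> 'v) \<Rightarrow> 'v set \<Rightarrow> ('v \<Rightarrow> 'v \<Rightarrow> complex) \<Rightarrow> 'v topology" where
  "krein_topology smul V B =
     (let J = SOME J. fundamental_symmetry smul V B J
      in Metric_space.mtopology V (form_dist V (\<lambda>x y. B (J x) y)))"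

(* A unitary operator is a surjective linear isometry for the indefinite form; its
   continuity is automatic. *)
definition krein_unitary ::
    "(complex \<Rightarrow> 'v::ab_group_add \<Rightarrow> 'v) \<Rightarrow> 'v set \<Rightarrow> ('v \<Rightarrow> 'v \<Rightarrow> complex) \<Rightarrow> ('v \<Rightarrow> 'v) \<Rightarrow> bool" where
  "krein_unitary smul V B U \<longleftrightarrow> linear_operator_on smul V U \<and> bij_betw U V V
     \<and> (\<forall>x\<in>V. \<forall>y\<in>V. B (U x) (U y) = B x y)"

definition regular_subspace ::
    "(complex \<Rightarrow> 'v::ab_group_add \<Rightarrow> 'v) \<Rightarrow> 'v set \<Rightarrow> ('v \<Rightarrow> 'v \<Rightarrow> complex) \<Rightarrow> 'v set \<Rightarrow> bool" where
  "regular_subspace smul V B M \<longleftrightarrow> M \<subseteq> V \<and> module.subspace smul M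
     \<and> closedin (krein_topology smul V B) M \<and> krein_space smul M B"

definition fun_scale :: "complex \<Rightarrow> ('x \<Rightarrow> complex) \<Rightarrow> 'x \<Rightarrow> complex" where
  "fun_scale c f = (\<lambda>x. c * f x)"

lemma vector_space_fun_scale: "vector_space (fun_scale :: complex \<Rightarrow> ('x \<Rightarrow> complex) \<Rightarrow> _)"
  by unfold_locales (auto simp: fun_scale_def fun_eq_iff algebra_simps)

locale rk_krein_space = krein_space fun_scale V B
  for V :: "('x \<Rightarrow> complex) set" and B +
  assumes continuous_inclusion:
    "continuous_map (krein_topology fun_scale V B) (product_topology (\<lambda>_. euclidean) UNIV) (\<lambda>f. f)"

definition reproducing_kernel ::
    "('x \<Rightarrow> complex) set \<Rightarrow> (('x \<Rightarrow> complex) \<Rightarrow> ('x \<Rightarrow> complex) \<Rightarrow> complex)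
       \<Rightarrow> ('x \<Rightarrow> 'x \<Rightarrow> complex) \<Rightarrow> bool" where
  "reproducing_kernel V B K \<longleftrightarrow> (\<forall>x. K x \<in> V \<and> (\<forall>k\<in>V. B (K x) k = k x))"

definition translation ::
    "('g, 'm) monoid_scheme \<Rightarrow> ('g \<Rightarrow> 'x \<Rightarrow> 'x) \<Rightarrow> 'g \<Rightarrow> ('x \<Rightarrow> complex) \<Rightarrow> 'x \<Rightarrow> complex" where
  "translation G \<phi> g f = (\<lambda>x. f (\<phi> (inv\<^bsub>G\<^esub> g) x))"

definition translation_invariant ::
    "('g, 'm) monoid_scheme \<Rightarrow> ('g \<Rightarrow> 'x \<Rightarrow> 'x) \<Rightarrow> ('x \<Rightarrow> complex) set \<Rightarrow> bool" where
  "translation_invariant G \<phi> M \<longleftrightarrow> (\<forall>g\<in>carrier G. translation G \<phi> g ` M \<subseteq> M)"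

definition unitarily_invariant ::
    "('g, 'm) monoid_scheme \<Rightarrow> ('g \<Rightarrow> 'x \<Rightarrow> 'x) \<Rightarrow> ('x \<Rightarrow> complex) set
       \<Rightarrow> (('x \<Rightarrow> complex) \<Rightarrow> ('x \<Rightarrow> complex) \<Rightarrow> complex) \<Rightarrow> bool" where
  "unitarily_invariant G \<phi> V B \<longleftrightarrow> translation_invariant G \<phi> V
     \<and> (\<forall>g\<in>carrier G. krein_unitary fun_scale V B (translation G \<phi> g))"

definition fixed_vectors ::
    "('g, 'm) monoid_scheme \<Rightarrow> ('g \<Rightarrow> 'x \<Rightarrow> 'x) \<Rightarrow> 'g set \<Rightarrow> ('x \<Rightarrow> complex) set
       \<Rightarrow> ('x \<Rightarrow> complex) set" where
  "fixed_vectors G \<phi> S V = {k \<in> V. \<forall>g\<in>S. translation G \<phi> g k = k}"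

definition regularly_irreducible ::
    "('g, 'm) monoid_scheme \<Rightarrow> ('g \<Rightarrow> 'x \<Rightarrow> 'x) \<Rightarrow> ('x \<Rightarrow> complex) set
       \<Rightarrow> (('x \<Rightarrow> complex) \<Rightarrow> ('x \<Rightarrow> complex) \<Rightarrow> complex) \<Rightarrow> bool" where
  "regularly_irreducible G \<phi> V B \<longleftrightarrow>
     (\<forall>M. regular_subspace fun_scale V B M \<and> translation_invariant G \<phi> M \<longrightarrow> M = {0} \<or> M = V)"

end

theory Submission
  imports Defs
begin

text \<open>A regular subspace M satisfies V = M + M', where M' is its orthogonal companion: the sum is
  dense because M is closed and nondegenerate, and it is closed because the Hilbert norm of M is
  dominated by the dual norm of the functionals [m,-] on M (uniform boundedness), so that the
  M-components of a convergent sequence converge in M.  Hence an invariant regular subspace M has a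
  reproducing kernel L, namely the projection of K.  By invariance both K(\<omega>,-) and L(\<omega>,-) are fixed
  by the isotropy group of \<omega>, so if the fixed vectors form a line then L = c K for a scalar c.
  If c = 0 then M = 0; otherwise M contains all K(x,-), whose orthogonal companion is 0,
  so M = V.\<close>

section \<open>Algebra of Hermitian forms on a subspace\<close>

context hermitian_space
begin

lemma V_add: "\<lbrakk>x \<in> V; y \<in> V\<rbrakk> \<Longrightarrow> x + y \<in> V"
  and V_diff: "\<lbrakk>x \<in> V; y \<in> V\<rbrakk> \<Longrightarrow> x - y \<in> V"
  and V_scale: "x \<in> V \<Longrightarrow> smul c x \<in> V"
  and V_zero: "0 \<in> V"
  using subspace_V subspace_add subspace_diff subspace_scale subspace_0 by blast+

lemma form_add_left: "\<lbrakk>x \<in> V; y \<in> V; z \<in> V\<rbrakk> \<Longrightarrow> B (x + y) z = B x z + B y z"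
  using form_add_right[of z x y] hermitian[of z "x + y"] hermitian[of z x] hermitian[of z y] V_add
  by simp

lemma form_scale_left: "\<lbrakk>x \<in> V; y \<in> V\<rbrakk> \<Longrightarrow> B (smul c x) y = cnj c * B x y"
  using form_scale_right[of y x c] hermitian[of y "smul c x"] hermitian[of y x] V_scale by simp

lemma form_diff_right: "\<lbrakk>x \<in> V; y \<in> V; z \<in> V\<rbrakk> \<Longrightarrow> B x (y - z) = B x y - B x z"
  using form_add_right[of x "y - z" z] V_diff by simp

lemma form_diff_left: "\<lbrakk>x \<in> V; y \<in> V; z \<in> V\<rbrakk> \<Longrightarrow> B (x - y) z = B x z - B y z"
  using form_add_left[of "x - y" y z] V_diff by simp

lemma form_zero_right: "x \<in> V \<Longrightarrow> B x 0 = 0"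
  using form_diff_right[of x x x] by simp

lemma form_zero_left: "x \<in> V \<Longrightarrow> B 0 x = 0"
  using form_diff_left[of x x x] by simp

end

section \<open>Norm and metric of a Hilbert form\<close>

context hilbert_space_on
begin

definition nrm :: "'v \<Rightarrow> real" where
  "nrm x = sqrt (Re (H x x))"

lemma form_self_nonneg: "x \<in> V \<Longrightarrow> 0 \<le> Re (H x x)"
  using positive[of x] form_zero_left[OF V_zero] by (cases "x = 0") auto

lemma nrm_nonneg: "x \<in> V \<Longrightarrow> 0 \<le> nrm x"
  by (simp add: nrm_def form_self_nonneg)

lemma nrm_square: "x \<in> V \<Longrightarrow> (nrm x)\<^sup>2 = Re (H x x)"
  by (simp add: nrm_def form_self_nonneg)

lemma form_self: "x \<in> V \<Longrightarrow> H x x = complex_of_real ((nrm x)\<^sup>2)"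
  using hermitian[of x x] by (simp add: nrm_square complex_eq_iff)

lemma nrm_eq_0_iff: "x \<in> V \<Longrightarrow> nrm x = 0 \<longleftrightarrow> x = 0"
  using positive[of x] form_zero_left[OF V_zero] by (cases "x = 0") (auto simp: nrm_def)

lemma nrm_scale: "x \<in> V \<Longrightarrow> nrm (smul c x) = cmod c * nrm x"
proof -
  assume x: "x \<in> V"
  have "H (smul c x) (smul c x) = complex_of_real ((cmod c * nrm x)\<^sup>2)"
    unfolding power_mult_distrib of_real_mult complex_norm_square form_self[OF x, symmetric]
    by (simp add: x form_scale_left form_scale_right V_scale)
  then show ?thesis
    using nrm_nonneg[OF x] by (simp add: nrm_def)
qed

lemma nrm_minus: "x \<in> V \<Longrightarrow> nrm (- x) = nrm x"
  using nrm_scale[of x "-1"] by simp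

lemma nrm_minus_commute: "\<lbrakk>x \<in> V; y \<in> V\<rbrakk> \<Longrightarrow> nrm (x - y) = nrm (y - x)"
  using nrm_minus[of "x - y"] V_diff by simp

lemma nrm_square_diff:
  assumes "x \<in> V" "y \<in> V"
  shows "(nrm (x - y))\<^sup>2 = (nrm x)\<^sup>2 + (nrm y)\<^sup>2 - 2 * Re (H x y)"
  using assms hermitian[of x y] by (simp add: nrm_square V_diff form_diff_left form_diff_right)

lemma nrm_square_add:
  assumes "x \<in> V" "y \<in> V"
  shows "(nrm (x + y))\<^sup>2 = (nrm x)\<^sup>2 + (nrm y)\<^sup>2 + 2 * Re (H x y)"
  using assms hermitian[of x y] by (simp add: nrm_square V_add form_add_left form_add_right)

lemma Cauchy_Schwarz:
  assumes x: "x \<in> V" and y: "y \<in> V"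
  shows "cmod (H x y) \<le> nrm x * nrm y"
proof (cases "y = 0")
  case True
  then show ?thesis using x y by (simp add: form_zero_right nrm_eq_0_iff[THEN iffD2])
next
  case False
  define n where "n = (nrm y)\<^sup>2"
  have n: "n > 0" using False y nrm_eq_0_iff by (simp add: n_def)
  \<comment> \<open>\<open>smul c y\<close> is the orthogonal projection of \<open>x\<close> onto
    the line through \<open>y\<close>; the inequality says that the remainder has nonnegative
    squared norm.\<close>
  define c where "c = H y x / of_real n"
  have yx: "H y x = cnj (H x y)" using hermitian[OF x y] .
  have "0 \<le> (nrm (x - smul c y))\<^sup>2" by simp
  also have "\<dots> = (nrm x)\<^sup>2 + (cmod c)\<^sup>2 * n - 2 * Re (c * H x y)"
    using x y by (simp add: nrm_square_diff V_scale nrm_scale form_scale_right n_def power_mult_distrib)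
  also have "c * H x y = of_real ((cmod (H x y))\<^sup>2 / n)"
    by (simp add: c_def yx complex_norm_square mult.commute flip: of_real_power)
  also have "(cmod c)\<^sup>2 * n = (cmod (H x y))\<^sup>2 / n"
    using n by (simp add: c_def yx norm_divide power_divide power2_eq_square)
  finally have "(cmod (H x y))\<^sup>2 / n \<le> (nrm x)\<^sup>2" by simp
  then have "(cmod (H x y))\<^sup>2 \<le> (nrm x * nrm y)\<^sup>2"
    using n by (simp add: n_def[symmetric] power_mult_distrib pos_divide_le_eq)
  then show ?thesis
    by (rule power2_le_imp_le) (simp add: x y nrm_nonneg)
qed

lemma nrm_triangle:
  assumes "x \<in> V" "y \<in> V"
  shows "nrm (x + y) \<le> nrm x + nrm y"
proof -
  have "Re (H x y) \<le> nrm x * nrm y"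
    using Cauchy_Schwarz[OF assms] complex_Re_le_cmod order_trans by blast
  then have "(nrm (x + y))\<^sup>2 \<le> (nrm x + nrm y)\<^sup>2"
    by (simp add: nrm_square_add assms power2_sum)
  then show ?thesis
    by (rule power2_le_imp_le) (simp add: assms nrm_nonneg)
qed

lemma parallelogram:
  assumes "x \<in> V" "y \<in> V"
  shows "(nrm (x + y))\<^sup>2 + (nrm (x - y))\<^sup>2 = 2 * (nrm x)\<^sup>2 + 2 * (nrm y)\<^sup>2"
  by (simp add: nrm_square_add nrm_square_diff assms)

lemma form_dist_eq: "\<lbrakk>x \<in> V; y \<in> V\<rbrakk> \<Longrightarrow> form_dist V H x y = nrm (x - y)"
  by (simp add: form_dist_def nrm_def)

sublocale metric: Metric_space V "form_dist V H"
proof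
  show "0 \<le> form_dist V H x y" for x y
    by (simp add: form_dist_def form_self_nonneg V_diff)
  show "form_dist V H x y = form_dist V H y x" for x y
    using nrm_minus_commute[of x y] by (simp add: form_dist_def nrm_def)
  show "form_dist V H x y = 0 \<longleftrightarrow> x = y" if "x \<in> V" "y \<in> V" for x y
    using that by (simp add: form_dist_eq nrm_eq_0_iff V_diff)
  show "form_dist V H x z \<le> form_dist V H x y + form_dist V H y z"
    if "x \<in> V" "y \<in> V" "z \<in> V" for x y z
    using that nrm_triangle[of "x - y" "y - z"] by (simp add: form_dist_eq V_diff)
qed

section \<open>Sequential limits, projection theorem and uniform boundedness\<close>

lemma limitin_iff_nrm:
  assumes "range s \<subseteq> V"
  shows "limitin metric.mtopology s l sequentially \<longleftrightarrow> l \<in> V \<and> (\<lambda>n. nrm (s n - l)) \<longlonglongrightarrow> 0"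
proof -
  have "form_dist V H (s n) l = nrm (s n - l)" if "l \<in> V" for n
    using that assms by (simp add: form_dist_eq range_subsetD)
  then show ?thesis
    using assms by (auto simp: metric.limitin_metric_dist_null range_subsetD)
qed

lemma closedinD:
  assumes "closedin metric.mtopology S" "range s \<subseteq> S" "l \<in> V" "(\<lambda>n. nrm (s n - l)) \<longlonglongrightarrow> 0"
  shows "l \<in> S"
proof -
  have "S \<subseteq> V" using assms(1) metric.closedin_metric by blast
  then have "limitin metric.mtopology s l sequentially"
    using assms by (subst limitin_iff_nrm) auto
  then show ?thesis using assms metric.metric_closedin_iff_sequentially_closed by blast
qed

lemma closedinI:
  assumes "S \<subseteq> V"
    and "\<And>s l. \<lbrakk>range s \<subseteq> S; l \<in> V; (\<lambda>n. nrm (s n - l)) \<longlonglongrightarrow> 0\<rbrakk> \<Longrightarrow> l \<in> S"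
  shows "closedin metric.mtopology S"
  unfolding metric.metric_closedin_iff_sequentially_closed
proof (intro conjI allI impI)
  fix s l assume "range s \<subseteq> S \<and> limitin metric.mtopology s l sequentially"
  then show "l \<in> S"
    using limitin_iff_nrm[of s l] assms by (meson order_trans)
qed (fact assms)

lemma Cauchy_convergent:
  assumes s: "range s \<subseteq> V"
    and cauchy: "\<And>e. e > 0 \<Longrightarrow> \<exists>N. \<forall>m\<ge>N. \<forall>n\<ge>N. nrm (s m - s n) < e"
  obtains l where "l \<in> V" "(\<lambda>n. nrm (s n - l)) \<longlonglongrightarrow> 0"
proof -
  have "form_dist V H (s m) (s n) = nrm (s m - s n)" for m n
    using s by (simp add: form_dist_eq range_subsetD)
  then have "metric.MCauchy s"
    unfolding metric.MCauchy_def using s cauchy by metis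
  then obtain l where "limitin metric.mtopology s l sequentially"
    using complete metric.mcomplete_def by blast
  then show thesis
    using limitin_iff_nrm[OF s] that by blast
qed

lemma tendsto_form_left:
  assumes s: "range s \<subseteq> V" and l: "l \<in> V" "(\<lambda>n. nrm (s n - l)) \<longlonglongrightarrow> 0" and y: "y \<in> V"
  shows "(\<lambda>n. H (s n) y) \<longlonglongrightarrow> H l y"
proof -
  have "cmod (H (s n) y - H l y) \<le> nrm (s n - l) * nrm y" for n
    using Cauchy_Schwarz[of "s n - l" y] s l(1) y by (simp add: V_diff form_diff_left range_subsetD)
  moreover have "(\<lambda>n. nrm (s n - l) * nrm y) \<longlonglongrightarrow> 0"
    using tendsto_mult_left_zero[OF l(2)] by simp
  ultimately have "(\<lambda>n. H (s n) y - H l y) \<longlonglongrightarrow> 0"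
    by (rule Lim_null_comparison[OF always_eventually[OF allI]])
  then show ?thesis by (rule LIM_zero_cancel)
qed

text \<open>A sequence in \<open>M\<close> minimising the distance to \<open>v\<close> is Cauchy by
  the parallelogram law. Its limit is a nearest point, and if \<open>v - m\<close> paired
  nontrivially with some \<open>k\<close>, a small move along \<open>k\<close> would come
  nearer.\<close>

lemma orthogonal_projection_exists:
  assumes M: "subspace M" and closed: "closedin metric.mtopology M" and v: "v \<in> V"
  obtains m where "m \<in> M" "\<And>k. k \<in> M \<Longrightarrow> H (v - m) k = 0"
proof -
  have MV: "M \<subseteq> V" using closed metric.closedin_metric by blast
  define D where "D = (\<lambda>m. (nrm (v - m))\<^sup>2) ` M"
  define d where "d = Inf D"
  have D: "D \<noteq> {}" "bdd_below D"
    using subspace_0[OF M] by (auto simp: D_def intro!: bdd_belowI[of _ 0])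
  have d_le: "d \<le> (nrm (v - m))\<^sup>2" if "m \<in> M" for m
    using that D(2) by (auto simp: d_def D_def intro: cInf_lower)
  have "\<exists>m\<in>M. (nrm (v - m))\<^sup>2 < d + 1 / Suc n" for n
    using cInf_lessD[OF D(1), of "d + 1 / Suc n"] by (auto simp: d_def D_def)
  then obtain s where sM: "\<And>n. s n \<in> M" and s: "\<And>n. (nrm (v - s n))\<^sup>2 < d + 1 / Suc n"
    by metis
  have sV: "s n \<in> V" for n using sM MV by blast
  have est: "(nrm (s m - s n))\<^sup>2 \<le> 2 / Suc m + 2 / Suc n" for m n
  proof -
    \<comment> \<open>The midpoint \<open>h\<close> lies in \<open>M\<close>, so its squared
      distance from \<open>v\<close> is at least \<open>d\<close>; the parallelogram law leaves for
      \<open>s m - s n\<close> only twice the excess of both terms over \<open>d\<close>.\<close>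
    define h where "h = smul (1/2) (s m + s n)"
    have hM: "h \<in> M" unfolding h_def using M sM by (intro subspace_scale subspace_add)
    have "(v - s m) + (v - s n) = smul 2 (v - h)"
      by (simp add: h_def scale_right_diff_distrib) (simp add: scale_left_distrib[of 1 1, simplified])
    then have "(nrm ((v - s m) + (v - s n)))\<^sup>2 = 4 * (nrm (v - h))\<^sup>2"
      using hM MV v by (auto simp: nrm_scale V_diff power_mult_distrib)
    moreover have "nrm ((v - s m) - (v - s n)) = nrm (s m - s n)"
      using nrm_minus_commute[OF sV[of m] sV[of n]] by simp
    ultimately show ?thesis
      using parallelogram[of "v - s m" "v - s n"] s[of m] s[of n] d_le[OF hM] v sV
      by (simp add: V_diff)
  qed
  have "\<exists>N. \<forall>m\<ge>N. \<forall>n\<ge>N. nrm (s m - s n) < e" if e: "e > 0" for e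
  proof -
    \<comment> \<open>The factor 4 appears because the two fractions in \<open>est\<close> add up to
      at most \<open>4 / Suc N\<close>.\<close>
    have "0 < e\<^sup>2 / 4" using e by simp
    then obtain N where "inverse (real (Suc N)) < e\<^sup>2 / 4"
      using reals_Archimedean by blast
    then have N: "4 / Suc N < e\<^sup>2" by (simp add: field_simps)
    have "nrm (s m - s n) < e" if "m \<ge> N" "n \<ge> N" for m n
    proof -
      have "2 / Suc m \<le> 2 / Suc N" "2 / Suc n \<le> 2 / Suc N"
        using that by (simp_all add: frac_le)
      then have "(nrm (s m - s n))\<^sup>2 < e\<^sup>2"
        using est[of m n] N by simp
      then show ?thesis by (rule power2_less_imp_less) (use that e in simp)
    qed
    then show ?thesis by blast
  qed
  then obtain l where l: "l \<in> V" "(\<lambda>n. nrm (s n - l)) \<longlonglongrightarrow> 0"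
    using Cauchy_convergent[of s] sV by blast
  then have lM: "l \<in> M"
    using closedinD[OF closed _ l] sM by blast
  \<comment> \<open>The distance from \<open>v\<close> to \<open>s n\<close> is controlled by
    \<open>d + 1 / Suc n\<close>, where \<open>d\<close> is at most the squared distance to
    \<open>m\<close>; the comparison survives as \<open>n\<close> grows and \<open>s n\<close> tends
    to \<open>l\<close>.\<close>
  have min: "nrm (v - l) \<le> nrm (v - m)" if "m \<in> M" for m
  proof (rule tendsto_le[OF sequentially_bot])
    show "(\<lambda>n. sqrt ((nrm (v - m))\<^sup>2 + 1 / Suc n) + nrm (s n - l)) \<longlonglongrightarrow> nrm (v - m)"
    proof -
      have "(\<lambda>n. sqrt ((nrm (v - m))\<^sup>2 + 1 / Suc n) + nrm (s n - l))
          \<longlonglongrightarrow> sqrt ((nrm (v - m))\<^sup>2 + 0) + 0"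
        using LIMSEQ_inverse_real_of_nat l(2)
        by (intro tendsto_intros) (simp_all add: inverse_eq_divide)
      then show ?thesis
        using that MV v nrm_nonneg[of "v - m"] by (auto simp: V_diff)
    qed
    show "\<forall>\<^sub>F n in sequentially.
        nrm (v - l) \<le> sqrt ((nrm (v - m))\<^sup>2 + 1 / Suc n) + nrm (s n - l)"
    proof (rule always_eventually, rule allI)
      fix n
      have "nrm (v - s n) \<le> sqrt ((nrm (v - m))\<^sup>2 + 1 / Suc n)"
        using s[of n] d_le[OF that] by (intro real_le_rsqrt) simp
      then show "nrm (v - l) \<le> sqrt ((nrm (v - m))\<^sup>2 + 1 / Suc n) + nrm (s n - l)"
        using nrm_triangle[of "v - s n" "s n - l"] v sV l(1) by (simp add: V_diff)
    qed
  qed simp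
  have "H (v - l) k = 0" if k: "k \<in> M" for k
  proof (rule ccontr)
    define u where "u = v - l"
    assume "H (v - l) k \<noteq> 0"
    then have h: "H u k \<noteq> 0" by (simp add: u_def)
    have uk: "u \<in> V" "k \<in> V" using v l(1) k MV by (auto simp: u_def V_diff)
    \<comment> \<open>Moving \<open>l\<close> by \<open>smul c k\<close> changes the squared
      distance by \<open>t * (cmod (H u k))\<^sup>2 * (t * (nrm k)\<^sup>2 - 2)\<close>; this
      \<open>t\<close> is small enough to make that negative.\<close>
    define t where "t = 1 / (1 + (nrm k)\<^sup>2)"
    have t: "t > 0" "t * (nrm k)\<^sup>2 < 1"
      by (simp_all add: t_def add_pos_nonneg divide_simps)
    define c where "c = of_real t * cnj (H u k)"
    have "v - (l + smul c k) = u - smul c k" by (simp add: u_def)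
    moreover have "l + smul c k \<in> M" using lM k M by (intro subspace_add subspace_scale)
    ultimately have "nrm u \<le> nrm (u - smul c k)"
      using min by (metis u_def)
    then have "(nrm u)\<^sup>2 \<le> (nrm (u - smul c k))\<^sup>2"
      using nrm_nonneg uk by (intro power_mono) auto
    also have "\<dots> = (nrm u)\<^sup>2 + (cmod c * nrm k)\<^sup>2 - 2 * Re (c * H u k)"
      using uk by (simp add: nrm_square_diff V_scale nrm_scale form_scale_right)
    also have "c * H u k = of_real (t * (cmod (H u k))\<^sup>2)"
      by (simp add: c_def complex_norm_square mult.commute mult.assoc flip: of_real_power)
    also have "cmod c = t * cmod (H u k)"
      using t by (simp add: c_def norm_mult)
    finally have "0 \<le> t * (cmod (H u k))\<^sup>2 * (t * (nrm k)\<^sup>2 - 2)"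
      by (simp add: power2_eq_square algebra_simps)
    moreover have "t * (cmod (H u k))\<^sup>2 * (t * (nrm k)\<^sup>2 - 2) < 0"
      using t h by (intro mult_pos_neg mult_pos_pos) auto
    ultimately show False by simp
  qed
  then show thesis using that lM by blast
qed

text \<open>Baire category argument: the closed sets \<open>E n\<close> on which all of
  \<open>F\<close> is bounded by \<open>n\<close> cover \<open>V\<close>, so one of them contains a
  ball, and linearity spreads the bound from there.\<close>

lemma uniform_boundedness:
  fixes F :: "('v \<Rightarrow> complex) set"
  assumes diff: "\<And>f x y. \<lbrakk>f \<in> F; x \<in> V; y \<in> V\<rbrakk> \<Longrightarrow> f (x - y) = f x - f y"
    and scale: "\<And>f c x. \<lbrakk>f \<in> F; x \<in> V\<rbrakk> \<Longrightarrow> f (smul c x) = c * f x"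
    and bounded: "\<And>f. f \<in> F \<Longrightarrow> \<exists>C. \<forall>x\<in>V. cmod (f x) \<le> C * nrm x"
    and pointwise: "\<And>x. x \<in> V \<Longrightarrow> \<exists>C. \<forall>f\<in>F. cmod (f x) \<le> C"
  obtains C where "\<And>f x. \<lbrakk>f \<in> F; x \<in> V\<rbrakk> \<Longrightarrow> cmod (f x) \<le> C * nrm x"
proof -
  define E where "E n = {x \<in> V. \<forall>f\<in>F. cmod (f x) \<le> real n}" for n
  have closed: "closedin metric.mtopology (E n)" for n
  proof (rule closedinI)
    fix s l assume s: "range s \<subseteq> E n" and l: "l \<in> V" "(\<lambda>n. nrm (s n - l)) \<longlonglongrightarrow> 0"
    have sE: "s i \<in> V" "\<And>f. f \<in> F \<Longrightarrow> cmod (f (s i)) \<le> real n" for i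
      using s by (auto simp: E_def)
    have "cmod (f l) \<le> real n" if f: "f \<in> F" for f
    proof -
      obtain C where C: "\<And>x. x \<in> V \<Longrightarrow> cmod (f x) \<le> C * nrm x"
        using bounded[OF f] by blast
      have "cmod (f (s i) - f l) \<le> C * nrm (s i - l)" for i
        using C[of "s i - l"] sE(1) l(1) diff[OF f] by (simp add: V_diff)
      moreover have "(\<lambda>i. C * nrm (s i - l)) \<longlonglongrightarrow> 0"
        using tendsto_mult_right_zero[OF l(2)] .
      ultimately have "(\<lambda>i. f (s i) - f l) \<longlonglongrightarrow> 0"
        by (rule Lim_null_comparison[OF always_eventually[OF allI]])
      then have "(\<lambda>i. cmod (f (s i))) \<longlonglongrightarrow> cmod (f l)"
        by (intro tendsto_norm) (rule LIM_zero_cancel)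
      then show ?thesis
        using sE(2)[OF f] by (intro LIMSEQ_le_const2) auto
    qed
    then show "l \<in> E n" using l(1) by (simp add: E_def)
  qed (auto simp: E_def)
  have cover: "\<Union>(range E) = V"
  proof (intro equalityI subsetI)
    fix x assume x: "x \<in> V"
    obtain C where C: "\<And>f. f \<in> F \<Longrightarrow> cmod (f x) \<le> C" using pointwise[OF x] by blast
    have "C \<le> real (nat \<lceil>C\<rceil>)" by linarith
    then have "x \<in> E (nat \<lceil>C\<rceil>)" using x C by (force simp: E_def)
    then show "x \<in> \<Union>(range E)" by blast
  qed (auto simp: E_def)
  have "metric.mtopology interior_of V = V"
    using interior_of_topspace[of metric.mtopology] by simp
  then have "metric.mtopology interior_of \<Union>(range E) \<noteq> {}"
    using V_zero cover by auto
  then obtain n where "metric.mtopology interior_of E n \<noteq> {}"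
    using metric.metric_Baire_category_alt[OF complete, of "range E"] closed by auto
  then obtain a e where a: "a \<in> V" and e: "e > 0" and ball: "metric.mcball a e \<subseteq> E n"
    using metric.in_interior_of_mcball by blast
  \<comment> \<open>Rescale \<open>x\<close> to norm \<open>e\<close>: then
    \<open>f (smul c x)\<close> is the difference of the values of \<open>f\<close> at
    \<open>a\<close> and \<open>a - smul c x\<close>, two points of the ball, hence at most
    \<open>2 * real n\<close> in modulus.\<close>
  have "cmod (f x) \<le> (2 * real n / e) * nrm x" if f: "f \<in> F" and x: "x \<in> V" for f x
  proof (cases "x = 0")
    case True
    then show ?thesis using diff[OF f x x] x by (simp add: nrm_eq_0_iff[THEN iffD2])
  next
    case False
    then have nx: "nrm x > 0" using x nrm_eq_0_iff[of x] nrm_nonneg[of x] by simp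
    define c where "c = complex_of_real (e / nrm x)"
    have "nrm (smul c x) = e" using nx e x by (simp add: nrm_scale c_def norm_divide)
    moreover have cx: "smul c x \<in> V" using x V_scale by blast
    ultimately have "form_dist V H a (a - smul c x) \<le> e"
      using a by (simp add: form_dist_eq V_diff)
    then have "a - smul c x \<in> E n" "a \<in> E n"
      using ball a cx e by (auto simp: V_diff intro!: subsetD[OF ball])
    then have "cmod (f a) \<le> n" "cmod (f a - f (smul c x)) \<le> n"
      using f a cx diff[OF f] by (auto simp: E_def)
    then have "cmod (f (smul c x)) \<le> 2 * real n"
      using norm_triangle_sub[of "f (smul c x)" "f a"] by (simp add: norm_minus_commute)
    then show ?thesis
      using nx e f x by (simp add: scale c_def norm_mult norm_divide field_simps)
  qed
  then show thesis using that by blast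
qed

end

section \<open>Krein spaces with a chosen fundamental symmetry, and decomposition along regular
  subspaces\<close>

locale krein_space_symmetry = hermitian_space smul V B
  for smul :: "complex \<Rightarrow> 'v::ab_group_add \<Rightarrow> 'v" and V B +
  fixes J :: "'v \<Rightarrow> 'v"
  assumes symmetry: "fundamental_symmetry smul V B J"
begin

sublocale hilbert: hilbert_space_on smul V "\<lambda>x y. B (J x) y"
  using symmetry by (simp add: fundamental_symmetry_def)

lemma J_closed: "x \<in> V \<Longrightarrow> J x \<in> V"
  and J_J: "x \<in> V \<Longrightarrow> J (J x) = x"
  using symmetry by (auto simp: fundamental_symmetry_def linear_operator_on_def)

lemma nrm_J: "x \<in> V \<Longrightarrow> hilbert.nrm (J x) = hilbert.nrm x"
  using hermitian[of "J x" x] J_closed[of x] by (simp add: hilbert.nrm_def J_J)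

text \<open>\<open>B x y\<close> is the Hilbert product of \<open>J x\<close> with \<open>y\<close>,
  and \<open>J\<close> preserves the Hilbert norm.\<close>

lemma form_bound:
  assumes "x \<in> V" "y \<in> V"
  shows "cmod (B x y) \<le> hilbert.nrm x * hilbert.nrm y"
  using hilbert.Cauchy_Schwarz[of "J x" y] assms by (simp add: J_closed J_J nrm_J)

lemma nondegenerate:
  assumes x: "x \<in> V" and zero: "\<And>y. y \<in> V \<Longrightarrow> B x y = 0"
  shows "x = 0"
proof -
  have "B (J x) x = cnj (B x (J x))" using x J_closed hermitian by blast
  then have "hilbert.nrm x = 0" using zero x J_closed by (simp add: hilbert.nrm_def)
  then show ?thesis using x hilbert.nrm_eq_0_iff by blast
qed

lemma tendsto_form:
  assumes s: "range s \<subseteq> V" and l: "l \<in> V" "(\<lambda>n. hilbert.nrm (s n - l)) \<longlonglongrightarrow> 0" and y: "y \<in> V"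
  shows "(\<lambda>n. B (s n) y) \<longlonglongrightarrow> B l y"
proof -
  \<comment> \<open>Both forms being Hermitian, \<open>B x y\<close> equals the Hilbert product of
    \<open>x\<close> with \<open>J y\<close>, so continuity is inherited from the Hilbert
    form.\<close>
  have "(\<lambda>n. cnj (B (J (J y)) (s n))) \<longlonglongrightarrow> cnj (B (J (J y)) l)"
  proof -
    have "(\<lambda>n. B (J (s n)) (J y)) \<longlonglongrightarrow> B (J l) (J y)"
      by (rule hilbert.tendsto_form_left[OF s l J_closed[OF y]])
    moreover have "B (J x) (J y) = cnj (B (J (J y)) x)" if "x \<in> V" for x
      using hilbert.hermitian[of "J y" x] that y J_closed by simp
    ultimately show ?thesis using s l(1) by (simp add: range_subsetD)
  qed
  moreover have "cnj (B (J (J y)) x) = B x y" if "x \<in> V" for x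
    using hermitian[of y x] that y by (simp add: J_J)
  ultimately show ?thesis using s l(1) by (simp add: range_subsetD)
qed

text \<open>The functionals [x,-] with dual norm at most 1 for the norm of V are pointwise bounded on
  the Hilbert space of M, hence uniformly bounded there; evaluating [x,-] at I x gives the claim.\<close>

lemma dual_norm_bound:
  assumes M: "krein_space_symmetry smul M B I"
  obtains C where "C > 0"
    "\<And>x a. \<lbrakk>x \<in> M; a > 0; \<And>k. k \<in> M \<Longrightarrow> cmod (B x k) \<le> a * hilbert.nrm k\<rbrakk>
      \<Longrightarrow> hilbert_space_on.nrm (\<lambda>x y. B (I x) y) x \<le> C * a"
proof -
  interpret M: krein_space_symmetry smul M B I by (rule M)
  define X where "X = {x \<in> M. \<forall>k\<in>M. cmod (B x k) \<le> hilbert.nrm k}"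
  have "\<exists>C. \<forall>f\<in>B ` X. \<forall>k\<in>M. cmod (f k) \<le> C * M.hilbert.nrm k"
  proof (rule M.hilbert.uniform_boundedness[of "B ` X"])
    show "f (x - y) = f x - f y" if "f \<in> B ` X" "x \<in> M" "y \<in> M" for f x y
      using that by (auto simp: X_def M.form_diff_right)
    show "f (smul c x) = c * f x" if "f \<in> B ` X" "x \<in> M" for f c x
      using that by (auto simp: X_def M.form_scale_right)
    show "\<exists>C. \<forall>x\<in>M. cmod (f x) \<le> C * M.hilbert.nrm x" if "f \<in> B ` X" for f
      using that M.form_bound by (auto simp: X_def)
    show "\<exists>C. \<forall>f\<in>B ` X. cmod (f x) \<le> C" if "x \<in> M" for x
      using that by (auto simp: X_def)
  qed blast
  then obtain C where C: "\<And>f k. \<lbrakk>f \<in> B ` X; k \<in> M\<rbrakk> \<Longrightarrow> cmod (f k) \<le> C * M.hilbert.nrm k"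
    by blast
  \<comment> \<open>On a zero space \<open>C\<close> could be nonpositive; the maximum with 1
    secures the positivity that is claimed.\<close>
  have main: "M.hilbert.nrm x \<le> max C 1" if x: "x \<in> X" for x
  proof -
    have xM: "x \<in> M" using x by (simp add: X_def)
    have Ix: "I x \<in> M" using xM M.J_closed by blast
    have "B x (I x) = cnj (B (I x) x)" using M.hermitian[OF Ix xM] .
    also have "\<dots> = complex_of_real ((M.hilbert.nrm x)\<^sup>2)" using M.hilbert.form_self[OF xM] by simp
    finally have "(M.hilbert.nrm x)\<^sup>2 \<le> C * M.hilbert.nrm x"
      using C[of "B x" "I x"] x xM Ix by (simp add: M.nrm_J norm_power)
    then have "M.hilbert.nrm x * (M.hilbert.nrm x - C) \<le> 0"
      by (simp add: power2_eq_square algebra_simps)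
    then show ?thesis using M.hilbert.nrm_nonneg[OF xM] by (auto simp: mult_le_0_iff)
  qed
  show thesis
  proof (rule that[of "max C 1"])
    fix x a assume x: "x \<in> M" and a: "a > 0"
      and le: "\<And>k. k \<in> M \<Longrightarrow> cmod (B x k) \<le> a * hilbert.nrm k"
    \<comment> \<open>Homogeneity reduces the bound \<open>a\<close> to dual norm at most 1, so that
      \<open>main\<close> applies.\<close>
    define y where "y = smul (of_real (1 / a)) x"
    have "cmod (B y k) \<le> hilbert.nrm k" if "k \<in> M" for k
      using le[OF that] x that a
      by (simp add: y_def M.form_scale_left norm_divide field_simps)
    then have "y \<in> X" using x by (simp add: X_def y_def M.V_scale)
    then have "M.hilbert.nrm y \<le> max C 1" using main by blast
    then show "M.hilbert.nrm x \<le> max C 1 * a"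
      using x a by (simp add: y_def M.hilbert.nrm_scale norm_divide field_simps)
  qed simp
qed

text \<open>The Hilbert projection onto \<open>M\<close> is orthogonal for the wrong form. It is
  applied instead to the sum \<open>Z\<close> of \<open>M\<close> and its companion
  \<open>W\<close>, once \<open>Z\<close> is known to be closed, to show that \<open>Z\<close> is
  all of \<open>V\<close>.\<close>

lemma regular_decomposition:
  assumes I: "krein_space_symmetry smul M B I"
    and closed: "closedin hilbert.metric.mtopology M" and v: "v \<in> V"
  obtains m where "m \<in> M" "\<And>k. k \<in> M \<Longrightarrow> B (v - m) k = 0"
proof -
  interpret M: krein_space_symmetry smul M B I by (rule I)
  have MV: "M \<subseteq> V" using closed hilbert.metric.closedin_metric by blast
  define W where "W = {w \<in> V. \<forall>k\<in>M. B w k = 0}"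
  define Z where "Z = {m + w | m w. m \<in> M \<and> w \<in> W}"
  have WV: "W \<subseteq> V" by (auto simp: W_def)
  have W: "subspace W"
    using MV by (intro subspaceI)
      (auto simp: W_def V_zero V_add V_scale form_zero_left form_add_left form_scale_left subset_iff)
  have Z: "subspace Z" "Z \<subseteq> V"
    using subspace_sums[OF M.subspace_V W] MV WV V_add by (auto simp: Z_def)
  have MZ: "M \<subseteq> Z" and WZ: "W \<subseteq> Z"
    using subspace_0[OF W] M.V_zero by (force simp: Z_def)+
  obtain C where C: "C > 0"
    "\<And>x a. \<lbrakk>x \<in> M; a > 0; \<And>k. k \<in> M \<Longrightarrow> cmod (B x k) \<le> a * hilbert.nrm k\<rbrakk>
      \<Longrightarrow> M.hilbert.nrm x \<le> C * a"
    using dual_norm_bound[OF I] by blast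
  have "closedin hilbert.metric.mtopology Z"
  proof (rule hilbert.closedinI)
    fix s l assume s: "range s \<subseteq> Z" and l: "l \<in> V" "(\<lambda>n. hilbert.nrm (s n - l)) \<longlonglongrightarrow> 0"
    have "\<exists>m\<in>M. s n - m \<in> W" for n
    proof -
      have "s n \<in> Z" using s by blast
      then show ?thesis by (force simp: Z_def)
    qed
    then obtain p where p: "\<And>n. p n \<in> M" "\<And>n. s n - p n \<in> W" by metis
    have sV: "s n \<in> V" for n using s Z(2) by blast
    \<comment> \<open>The \<open>W\<close>-component is invisible to \<open>M\<close>, so the
      functionals of \<open>p n\<close> on \<open>M\<close> are governed by the convergent sequence
      \<open>s\<close>.\<close>
    have form_p: "B (p n) k = B (s n) k" if "k \<in> M" for n k
    proof -
      have "B (s n - p n) k = 0" using p(2) that by (simp add: W_def)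
      then show ?thesis using form_diff_left[of "s n" "p n" k] sV p(1) MV that by (auto simp: subset_iff)
    qed
    have "\<exists>N. \<forall>m\<ge>N. \<forall>n\<ge>N. M.hilbert.nrm (p m - p n) < e" if e: "e > 0" for e
    proof -
      \<comment> \<open>Two terms within \<open>d\<close> of \<open>l\<close> differ by at most
        \<open>2 * d\<close>, and the dual norm bound turns this into \<open>C * (2 * d)\<close>,
        which is half of \<open>e\<close>.\<close>
      define d where "d = e / (4 * C)"
      have d: "d > 0" using e C by (simp add: d_def)
      obtain N where N: "\<And>n. n \<ge> N \<Longrightarrow> hilbert.nrm (s n - l) < d"
        using LIMSEQ_D[OF l(2) d] by (auto simp: abs_less_iff)
      have "M.hilbert.nrm (p m - p n) < e" if mn: "m \<ge> N" "n \<ge> N" for m n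
      proof -
        have sd: "hilbert.nrm (s m - s n) \<le> 2 * d"
          using hilbert.nrm_triangle[of "s m - l" "l - s n"] N[OF mn(1)] N[OF mn(2)]
            hilbert.nrm_minus_commute[of l "s n"] sV l(1) by (simp add: V_diff)
        have "M.hilbert.nrm (p m - p n) \<le> C * (2 * d)"
        proof (rule C(2))
          fix k assume k: "k \<in> M"
          have "B (p m - p n) k = B (s m - s n) k"
            using form_p[OF k] p(1) k MV sV by (simp add: M.form_diff_left form_diff_left subset_iff)
          also have "cmod \<dots> \<le> hilbert.nrm (s m - s n) * hilbert.nrm k"
            using form_bound sV k MV V_diff by blast
          also have "\<dots> \<le> 2 * d * hilbert.nrm k"
            using sd hilbert.nrm_nonneg k MV by (intro mult_right_mono) auto
          finally show "cmod (B (p m - p n) k) \<le> 2 * d * hilbert.nrm k" .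
        qed (use p(1) M.V_diff d in auto)
        also have "\<dots> < e" using e C by (simp add: d_def)
        finally show ?thesis .
      qed
      then show ?thesis by blast
    qed
    then obtain q where q: "q \<in> M" "(\<lambda>n. M.hilbert.nrm (p n - q)) \<longlonglongrightarrow> 0"
      using M.hilbert.Cauchy_convergent[of p] p(1) by blast
    \<comment> \<open>One scalar sequence has two limits: \<open>B q k\<close> through the norm of
      \<open>M\<close>, and \<open>B l k\<close> through the norm of \<open>V\<close>.\<close>
    have "B (l - q) k = 0" if k: "k \<in> M" for k
    proof -
      have "(\<lambda>n. B (p n) k) \<longlonglongrightarrow> B q k"
        using M.tendsto_form[OF _ q k] p(1) by blast
      moreover have "(\<lambda>n. B (s n) k) \<longlonglongrightarrow> B l k"
        using tendsto_form[OF _ l] k MV sV by blast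
      ultimately have "B l k = B q k"
        using form_p[OF k] LIMSEQ_unique by simp blast
      then show ?thesis using l(1) q(1) k MV by (simp add: form_diff_left subset_iff)
    qed
    then have "l - q \<in> W" using l(1) q(1) MV V_diff by (auto simp: W_def)
    then have "q + (l - q) \<in> Z" using q(1) unfolding Z_def by blast
    then show "l \<in> Z" by simp
  qed (fact Z)
  then obtain z where z: "z \<in> Z" "\<And>k. k \<in> Z \<Longrightarrow> B (J (v - z)) k = 0"
    using hilbert.orthogonal_projection_exists[OF Z(1) _ v] by blast
  \<comment> \<open>Applying \<open>J\<close> turns Hilbert orthogonality of \<open>v - z\<close> to
    \<open>Z\<close> into orthogonality of \<open>y\<close> to \<open>Z\<close> for
    \<open>B\<close>; the aim is \<open>y = 0\<close>.\<close>
  define y where "y = J (v - z)"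
  have vz: "v - z \<in> V" using v z(1) Z(2) V_diff by blast
  have yV: "y \<in> V" using vz J_closed by (simp add: y_def)
  have y: "B y k = 0" if "k \<in> Z" for k using z(2) that by (simp add: y_def)
  \<comment> \<open>With \<open>m\<close> the Hilbert projection of \<open>y\<close> onto
    \<open>M\<close>, \<open>J (y - m)\<close> lies in \<open>W\<close>, hence in \<open>Z\<close>.
    So \<open>y - m\<close> is Hilbert orthogonal to \<open>y\<close> as well as to
    \<open>m\<close>, and vanishes; \<open>y\<close> then lies in \<open>M\<close> and is orthogonal
    to \<open>M\<close>, which is nondegenerate.\<close>
  obtain m where m: "m \<in> M" "\<And>k. k \<in> M \<Longrightarrow> B (J (y - m)) k = 0"
    using hilbert.orthogonal_projection_exists[OF M.subspace_V closed yV] by blast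
  have u: "y - m \<in> V" "m \<in> V" using yV m(1) MV V_diff by blast+
  then have JuW: "J (y - m) \<in> W" using m(2) J_closed by (simp add: W_def)
  have "B (J (y - m)) y = 0"
    using y[of "J (y - m)"] JuW WZ WV yV hermitian[of y "J (y - m)"] by (simp add: subset_iff)
  then have "B (J (y - m)) (y - m) = 0"
    using m u yV J_closed by (simp add: form_diff_right)
  then have "hilbert.nrm (y - m) = 0" by (simp add: hilbert.nrm_def)
  then have "y \<in> M" using u(1) m(1) hilbert.nrm_eq_0_iff by auto
  then have "y = 0" using y MZ by (intro M.nondegenerate) auto
  then have "hilbert.nrm (v - z) = 0"
    using nrm_J[OF vz] hilbert.nrm_eq_0_iff[OF V_zero] by (simp add: y_def)
  then have "v \<in> Z" using z(1) hilbert.nrm_eq_0_iff[OF vz] by simp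
  then obtain m w where "m \<in> M" "w \<in> W" "v = m + w" by (auto simp: Z_def)
  then show thesis using that[of m] by (simp add: W_def)
qed

end

lemma (in krein_space) regular_subspace_projection:
  assumes M: "regular_subspace smul V B M" and v: "v \<in> V"
  obtains m where "m \<in> M" "\<And>k. k \<in> M \<Longrightarrow> B (v - m) k = 0"
proof -
  \<comment> \<open>Closedness of \<open>M\<close> refers to \<open>krein_topology\<close>, so
    \<open>J\<close> must be the symmetry chosen there; on \<open>M\<close> any symmetry will
    do.\<close>
  define J where "J = (SOME J. fundamental_symmetry smul V B J)"
  have J: "fundamental_symmetry smul V B J"
    unfolding J_def using ex_fundamental_symmetry by (rule someI_ex)
  interpret V: krein_space_symmetry smul V B J
    by unfold_locales (fact J)
  have closed: "closedin V.hilbert.metric.mtopology M"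
    using M by (simp add: regular_subspace_def krein_topology_def J_def Let_def)
  have "krein_space smul M B" using M by (simp add: regular_subspace_def)
  then interpret M: krein_space smul M B .
  obtain I where I: "fundamental_symmetry smul M B I"
    using M.ex_fundamental_symmetry by blast
  have "krein_space_symmetry smul M B I"
    by unfold_locales (fact I)
  then show thesis
    using V.regular_decomposition closed v that by blast
qed

section \<open>Translations, equivariance of kernels, and irreducibility\<close>

lemma (in group_action) translation_translation_inv:
  assumes "E = UNIV" "g \<in> carrier G"
  shows "translation G \<phi> g (translation G \<phi> (inv g) f) = f"
proof -
  interpret group G using group_hom by (simp add: group_hom_def)
  show ?thesis
    using orbit_sym_aux[of "inv g"] assms by (simp add: translation_def)
qed

text \<open>Isometry moves \<open>g\<close> across the form, where evaluation picks it up in the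
  argument. The space \<open>M\<close> is kept general to cover both the whole space and an
  invariant regular subspace.\<close>

lemma (in group_action) reproducing_kernel_translation:
  assumes E: "E = UNIV"
    and form: "hermitian_space fun_scale M B"
    and inv: "translation_invariant G \<phi> M"
    and isometry: "\<And>g f h. \<lbrakk>g \<in> carrier G; f \<in> M; h \<in> M\<rbrakk>
      \<Longrightarrow> B (translation G \<phi> g f) (translation G \<phi> g h) = B f h"
    and L: "reproducing_kernel M B L"
    and g: "g \<in> carrier G"
  shows "L (\<phi> g x) = translation G \<phi> g (L x)"
proof
  interpret group G using group_hom by (simp add: group_hom_def)
  interpret hermitian_space fun_scale M B by (rule form)
  let ?T = "translation G \<phi>"
  have LM: "L y \<in> M" and L_eval: "k \<in> M \<Longrightarrow> B (L y) k = k y" for y k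
    using L by (auto simp: reproducing_kernel_def)
  have T: "?T h f \<in> M" if "h \<in> carrier G" "f \<in> M" for h f
    using inv that by (auto simp: translation_invariant_def)
  fix y
  \<comment> \<open>Up to conjugation, pairing with \<open>L y\<close> evaluates at
    \<open>y\<close>, so both sides are compared through this pairing.\<close>
  have "B (?T g (L x)) (L y) = B (?T g (L x)) (?T g (?T (inv g) (L y)))"
    by (simp add: translation_translation_inv E g)
  also have "\<dots> = B (L x) (?T (inv g) (L y))"
    using g LM T by (intro isometry) auto
  also have "\<dots> = ?T (inv g) (L y) x"
    using g LM T by (intro L_eval) auto
  also have "\<dots> = L y (\<phi> g x)" using g by (simp add: translation_def)
  also have "\<dots> = B (L (\<phi> g x)) (L y)" using L_eval LM by simp
  finally have "B (L y) (?T g (L x)) = B (L y) (L (\<phi> g x))"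
    using hermitian[of _ "L y"] LM T[OF g LM] by metis
  then show "L (\<phi> g x) y = ?T g (L x) y" using L_eval LM T[OF g LM] by simp
qed

lemma (in vector_space) dim_1_scale_ex:
  assumes "dim F = 1" "x \<in> F" "x \<noteq> 0" "y \<in> F"
  obtains c where "y = scale c x"
proof -
  \<comment> \<open>An infinite basis would have \<open>card\<close> 0, so the value 1 does give a
    single spanning vector.\<close>
  obtain b where "F \<subseteq> span b" "card b = 1"
    using basis_exists[of F] assms(1) by metis
  then obtain e where F: "F \<subseteq> range (\<lambda>k. scale k e)"
    by (metis card_1_singletonE span_singleton)
  obtain p q where "x = scale p e" "y = scale q e" using F assms by blast
  then show thesis using assms(3) that[of "q / p"] by auto
qed

theorem theorem2p17:
  fixes G :: "('g, 'm) monoid_scheme" and \<phi> :: "'g \<Rightarrow> 'x \<Rightarrow> 'x"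
    and V :: "('x \<Rightarrow> complex) set" and B :: "('x \<Rightarrow> complex) \<Rightarrow> ('x \<Rightarrow> complex) \<Rightarrow> complex"
    and K :: "'x \<Rightarrow> 'x \<Rightarrow> complex" and \<omega> :: 'x
  assumes "transitive_action G UNIV \<phi>"
    and "rk_krein_space V B"
    and "unitarily_invariant G \<phi> V B"
    and "reproducing_kernel V B K"
  shows "(\<forall>g\<in>carrier G. \<forall>x y. K (\<phi> g x) (\<phi> g y) = K x y)
    \<and> (V \<noteq> {0} \<longrightarrow> fixed_vectors G \<phi> (stabilizer G \<phi> \<omega>) V \<noteq> {0})
    \<and> (vector_space.dim fun_scale (fixed_vectors G \<phi> (stabilizer G \<phi> \<omega>) V) = 1
         \<longrightarrow> regularly_irreducible G \<phi> V B)"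
proof -
  interpret transitive_action G UNIV \<phi> by fact
  interpret rk_krein_space V B by fact
  let ?T = "translation G \<phi>"
  let ?F = "fixed_vectors G \<phi> (stabilizer G \<phi> \<omega>) V"
  have inv: "translation_invariant G \<phi> V"
    and isometry: "\<And>g f h. \<lbrakk>g \<in> carrier G; f \<in> V; h \<in> V\<rbrakk> \<Longrightarrow> B (?T g f) (?T g h) = B f h"
    using assms(3) by (auto simp: unitarily_invariant_def krein_unitary_def)
  have KV: "K x \<in> V" and K_eval: "k \<in> V \<Longrightarrow> B (K x) k = k x" for x k
    using assms(4) by (auto simp: reproducing_kernel_def)
  have orbit: "\<exists>g\<in>carrier G. x = \<phi> g \<omega>" for x
    using unique_orbit[of \<omega> x] by auto
  have kernel_trivial: "M \<subseteq> {0}" if "reproducing_kernel M B L" "L = (\<lambda>x. 0)" "M \<subseteq> V" for M L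
  proof
    fix k assume k: "k \<in> M"
    have "k x = B (L x) k" for x
      using that(1) k by (simp add: reproducing_kernel_def)
    also have "B (L x) k = 0" for x
      using that(2,3) k form_zero_left[of k] by (simp add: subset_iff)
    finally have "k x = 0" for x .
    then show "k \<in> {0}" by auto
  qed
  \<comment> \<open>By transitivity an equivariant kernel is determined by its section at
    \<open>\<omega>\<close>.\<close>
  have kernel_eq: "L = L'" if "\<And>g x. g \<in> carrier G \<Longrightarrow> L (\<phi> g x) = ?T g (L x)"
    "\<And>g x. g \<in> carrier G \<Longrightarrow> L' (\<phi> g x) = ?T g (L' x)" "L \<omega> = L' \<omega>" for L L'
  proof
    fix x
    obtain g where "g \<in> carrier G" "x = \<phi> g \<omega>" using orbit by blast
    then show "L x = L' x" using that by simp
  qed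
  have K_trans: "K (\<phi> g x) = ?T g (K x)" if "g \<in> carrier G" for g x
    by (rule reproducing_kernel_translation[OF refl hermitian_space_axioms inv isometry assms(4) that])
  \<comment> \<open>For \<open>g\<close> in the stabilizer, \<open>K_trans\<close> reads
    \<open>K \<omega> = ?T g (K \<omega>)\<close>.\<close>
  have K_fixed: "K \<omega> \<in> ?F"
    using KV by (auto simp: fixed_vectors_def stabilizer_def simp flip: K_trans)
  have K_nonzero: "K \<omega> \<noteq> 0" if "V \<noteq> {0}"
  proof
    assume "K \<omega> = 0"
    then have "K = (\<lambda>x. 0)"
      using K_trans by (intro kernel_eq) (auto simp: translation_def fun_eq_iff)
    then show False using kernel_trivial[OF assms(4)] V_zero that by auto
  qed
  have "M = {0} \<or> M = V" if dim: "dim ?F = 1"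
    and M: "regular_subspace fun_scale V B M" and inv_M: "translation_invariant G \<phi> M" for M
  proof -
    interpret M: krein_space fun_scale M B using M by (simp add: regular_subspace_def)
    have MV: "M \<subseteq> V" using M by (simp add: regular_subspace_def)
    have "V \<noteq> {0}"
    proof
      assume "V = {0}"
      then have "?F \<subseteq> span {}" by (auto simp: fixed_vectors_def)
      then have "dim ?F \<le> card ({} :: ('x \<Rightarrow> complex) set)" by (rule dim_le_card) simp
      then show False using dim by simp
    qed
    then have "K \<omega> \<noteq> 0" by (rule K_nonzero)
    \<comment> \<open>Projecting each \<open>K x\<close> to \<open>M\<close> keeps its pairings with
      \<open>M\<close>, and so yields the reproducing kernel of \<open>M\<close>.\<close>
    have "\<exists>m\<in>M. \<forall>k\<in>M. B (K x - m) k = 0" for x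
      using regular_subspace_projection[OF M KV] by metis
    then obtain L where LM: "\<And>x. L x \<in> M" and L: "\<And>x k. k \<in> M \<Longrightarrow> B (K x - L x) k = 0"
      by metis
    have kernel_L: "reproducing_kernel M B L"
      unfolding reproducing_kernel_def
    proof (intro allI conjI ballI)
      fix x k assume k: "k \<in> M"
      then have "B (K x) k - B (L x) k = 0"
        using L[OF k, of x] form_diff_left[of "K x" "L x" k] KV LM MV by auto
      then show "B (L x) k = k x" using K_eval k MV by auto
    qed (rule LM)
    have L_trans: "L (\<phi> g x) = ?T g (L x)" if "g \<in> carrier G" for g x
      using reproducing_kernel_translation[OF refl M.hermitian_space_axioms inv_M _ kernel_L that]
        isometry MV by blast
    have "L \<omega> \<in> ?F"
      using LM MV by (auto simp: fixed_vectors_def stabilizer_def simp flip: L_trans)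
    then obtain c where c: "L \<omega> = fun_scale c (K \<omega>)"
      using dim_1_scale_ex[OF dim K_fixed \<open>K \<omega> \<noteq> 0\<close>] by blast
    have LK: "L = (\<lambda>x. fun_scale c (K x))"
      using L_trans K_trans c
      by (intro kernel_eq) (auto simp: translation_def fun_scale_def)
    show ?thesis
    proof (cases "c = 0")
      case True
      then have "M \<subseteq> {0}" using LK MV by (intro kernel_trivial[OF kernel_L]) auto
      then show ?thesis using M.V_zero by blast
    next
      case False
      then have KM: "K x \<in> M" for x
        using M.V_scale[OF LM[of x], of "1 / c"] by (simp add: LK)
      have "v \<in> M" if v: "v \<in> V" for v
      proof -
        obtain m where m: "m \<in> M" "\<And>k. k \<in> M \<Longrightarrow> B (v - m) k = 0"
          using regular_subspace_projection[OF M v] by blast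
        have d: "v - m \<in> V" using v m(1) MV V_diff by blast
        \<comment> \<open>All \<open>K x\<close> lie in \<open>M\<close>, so orthogonality of
          \<open>v - m\<close> to \<open>M\<close> makes every value of \<open>v - m\<close>
          vanish.\<close>
        have "(v - m) x = 0" for x
          using m(2)[OF KM] K_eval[OF d] hermitian[OF d KV] by (metis complex_cnj_zero)
        then have "v - m = 0" by (simp only: fun_eq_iff zero_fun_apply) simp
        then show ?thesis using m(1) by simp
      qed
      then show ?thesis using MV by blast
    qed
  qed
  then have "dim ?F = 1 \<longrightarrow> regularly_irreducible G \<phi> V B"
    unfolding regularly_irreducible_def by simp
  moreover have "V \<noteq> {0} \<longrightarrow> ?F \<noteq> {0}"
    using K_fixed K_nonzero by (metis singletonD)
  moreover have "K (\<phi> g x) (\<phi> g y) = K x y" if "g \<in> carrier G" for g x y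
    using K_trans[OF that] orbit_sym_aux[OF that, of y] by (simp add: translation_def)
  ultimately show ?thesis
    by (intro conjI ballI allI) assumption+
qed

end
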